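(* Let $h\ge2$, let $a/b$ be an $h$-Farey fraction with predecessor $a'/b'$, $\Delta\subset\mathbb N$ finite with $\delta_1=\max\Delta$, $\tau,m$ integers, and $S=S(h,a/b,\Delta,\tau,m)=\langle m,\Gamma\rangle_c$ satisfying the standing assumptions below, with $t$ and $w$ as defined there. Let $\bar b=b\bmod b'\in\{0,\dots,b'-1\}$ and let $\mathbb 1_{b'=h}$ be $1$ if $b'=h$ and $0$ otherwise. Consider the conditions (1) $t\ge \frac{(h-b)w}{b}$; (2) $(b-\bar b)\,m\ge \frac{bb'\,[(h-\bar b)w-\bar b t]}{h}$; (3) $m\ge \frac{bb't}{h}+b\,(w+\mathbb 1_{b'=h})$. Then: (i) if $S$ is canonically defined, $S$ is short if and only if (1) and (2) hold; (ii) $S$ is split if and only if (1) and (3) hold; (iii) the semigroup $\hat S(h,a/b,\Delta)=S(h,a/b,\Delta,\hat\tau,\hat m)$, where $\hat\tau=\left\lfloor \frac{(h-b)(h\delta_1+1)}{b}\right\rfloor$ and $\hat m=[(b+b')h-bb']\delta_1+b+b'$, is split; and if $S$ is split, then $\tau\ge\hat\tau$ and $m\ge\hat m$.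
   Context: For a positive integer $m$, a finite set $\Gamma$ of integers larger than $m$ and an integer $c>m$, $\langle m,\Gamma\rangle_c$ denotes the submonoid of $(\mathbb N,+)$ generated by $m$, the elements of $\Gamma$ and all integers $\ge c$. An element $x>0$ of such a semigroup $S$ is primitive if it is not the sum of two nonzero elements of $S$; $S$ is canonically defined if $m$ and all elements of $\Gamma$ are primitive and $c-1\notin S$. For a finite set $A$ and $i\ge0$, $iA=\{a_1+\dots+a_i:a_j\in A\}$ ($0A=\{0\}$). Let $h\ge2$. An $h$-Farey fraction is a reduced fraction $a/b$ with $a\in\mathbb Z$, $1\le b\le h$; its predecessor $a'/b'$ is the largest $h$-Farey fraction strictly less than $a/b$ (in lowest terms, $1\le b'\le h$); one has $ab'-a'b=1$. For a finite $\Delta\subset\mathbb N$ and integers $\tau,m$, define $S(h,a/b,\Delta,\tau,m)=\langle m,\Gamma\rangle_c$ with $c=\lfloor ahm/b\rfloor-m-\tau$ and $\Gamma=\{\lfloor (c+m-1)/h\rfloor-\delta:\delta\in\Delta\}$. Put $\gamma_1=\min\Gamma$, $t=ahm/b-c-m$, $w=c+m-h\gamma_1$. Standing assumptions (made throughout for such semigroups): all elements of $\Gamma$ exceed $m$; $m\ge w$ (equivalently $h\Gamma\subset[c,c+m)$); and $a'/b'<(c+m)/(hm)\le a/b$. Short: an element $\lambda\in i\Gamma$ with $0\le i\le h-1$ is short if $\lceil (c-\lambda)/m\rceil\ge\lfloor (h-i)a'/b'\rfloor$ and long otherwise; $S$ is short if every $\lambda\in i\Gamma$, $0\le i\le h-1$,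 is short. Split: let $U_0=\{0\}$ and $U_i=[i\gamma_1,\,i(c+m)/h)\subset\mathbb R$ for $1\le i\le h$; $S$ is split if the sets $U_0,\dots,U_h$ are pairwise disjoint modulo $m$ (their images in $\mathbb R/m\mathbb Z$ are pairwise disjoint).
   Formalization: In the definition of short, the inequality ⌈(c−λ)/m⌉ ≥ ⌊(h−i)a'/b'⌋ is replaced by ≤ : under the standing assumptions ≥ always holds, which makes (i) false (e.g. h=2, a/b=2/1, Δ={0,2}, τ=1, m=5). *)

theory Defs
  imports Complex_Main "HOL-Library.Disjoint_Sets" "HOL-Library.Real_Mod"
begin

text \<open>
  All semigroups below are generated by positive integers, so submonoids of
  \<^typ>\<open>nat\<close> are represented as sets of nonnegative elements of \<^typ>\<open>int\<close>.
\<close>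

inductive_set generated_monoid :: "int set \<Rightarrow> int set" for G where
  zero: "0 \<in> generated_monoid G"
| add: "x \<in> generated_monoid G \<Longrightarrow> g \<in> G \<Longrightarrow> x + g \<in> generated_monoid G"

definition semigroup_cond :: "int \<Rightarrow> int set \<Rightarrow> int \<Rightarrow> int set" where
  "semigroup_cond m \<Gamma> c = generated_monoid ({m} \<union> \<Gamma> \<union> {c..})"

definition primitive :: "int set \<Rightarrow> int \<Rightarrow> bool" where
  "primitive S x \<longleftrightarrow> x \<in> S \<and> x > 0 \<and> \<not> (\<exists>y\<in>S. \<exists>z\<in>S. y \<noteq> 0 \<and> z \<noteq> 0 \<and> x = y + z)"

definition canonically_defined :: "int \<Rightarrow> int set \<Rightarrow> int \<Rightarrow> bool" where
  "canonically_defined m \<Gamma> c \<longleftrightarrow>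
     primitive (semigroup_cond m \<Gamma> c) m \<and>
     (\<forall>\<gamma>\<in>\<Gamma>. primitive (semigroup_cond m \<Gamma> c) \<gamma>) \<and>
     c - 1 \<notin> semigroup_cond m \<Gamma> c"

definition iterated_sumset :: "nat \<Rightarrow> int set \<Rightarrow> int set" where
  "iterated_sumset i A = {sum_list xs | xs. length xs = i \<and> set xs \<subseteq> A}"

definition farey_fraction :: "int \<Rightarrow> int \<Rightarrow> int \<Rightarrow> bool" where
  "farey_fraction h a b \<longleftrightarrow> 1 \<le> b \<and> b \<le> h \<and> coprime a b"

definition farey_pred :: "int \<Rightarrow> int \<Rightarrow> int \<Rightarrow> int \<Rightarrow> int \<Rightarrow> bool" where
  "farey_pred h a b a' b' \<longleftrightarrow>
     farey_fraction h a' b' \<and>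
     real_of_int a' / real_of_int b' < real_of_int a / real_of_int b \<and>
     (\<forall>p q. farey_fraction h p q \<and>
            real_of_int p / real_of_int q < real_of_int a / real_of_int b \<longrightarrow>
            real_of_int p / real_of_int q \<le> real_of_int a' / real_of_int b')"

text \<open>
  The data of the semigroup \<open>S(h, a/b, \<Delta>, \<tau>, m)\<close>. The definitions are meant for
  finite nonempty \<open>\<Delta>\<close> only.
\<close>

definition cS :: "int \<Rightarrow> int \<Rightarrow> int \<Rightarrow> int \<Rightarrow> int \<Rightarrow> int" where
  "cS h a b \<tau> m = \<lfloor>real_of_int (a * h * m) / real_of_int b\<rfloor> - m - \<tau>"

definition GammaS :: "int \<Rightarrow> int \<Rightarrow> int \<Rightarrow> nat set \<Rightarrow> int \<Rightarrow> int \<Rightarrow> int set" where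
  "GammaS h a b \<Delta> \<tau> m =
     (\<lambda>\<delta>. \<lfloor>real_of_int (cS h a b \<tau> m + m - 1) / real_of_int h\<rfloor> - int \<delta>) ` \<Delta>"

definition gamma1S :: "int \<Rightarrow> int \<Rightarrow> int \<Rightarrow> nat set \<Rightarrow> int \<Rightarrow> int \<Rightarrow> int" where
  "gamma1S h a b \<Delta> \<tau> m = Min (GammaS h a b \<Delta> \<tau> m)"

definition tS :: "int \<Rightarrow> int \<Rightarrow> int \<Rightarrow> int \<Rightarrow> int \<Rightarrow> real" where
  "tS h a b \<tau> m =
     real_of_int (a * h * m) / real_of_int b - real_of_int (cS h a b \<tau> m) - real_of_int m"

definition wS :: "int \<Rightarrow> int \<Rightarrow> int \<Rightarrow> nat set \<Rightarrow> int \<Rightarrow> int \<Rightarrow> int" where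
  "wS h a b \<Delta> \<tau> m = cS h a b \<tau> m + m - h * gamma1S h a b \<Delta> \<tau> m"

text \<open>
  The first three conjuncts say that the semigroup is of the form \<open>\<langle>m, \<Gamma>\<rangle>\<^sub>c\<close>
  at all; \<open>a'/b'\<close> is the predecessor of \<open>a/b\<close>.
\<close>

definition standing :: "int \<Rightarrow> int \<Rightarrow> int \<Rightarrow> int \<Rightarrow> int \<Rightarrow> nat set \<Rightarrow> int \<Rightarrow> int \<Rightarrow> bool" where
  "standing h a b a' b' \<Delta> \<tau> m \<longleftrightarrow>
     0 < m \<and> m < cS h a b \<tau> m \<and> (\<forall>\<gamma>\<in>GammaS h a b \<Delta> \<tau> m. m < \<gamma>) \<and>
     wS h a b \<Delta> \<tau> m \<le> m \<and>
     real_of_int a' / real_of_int b'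
       < real_of_int (cS h a b \<tau> m + m) / real_of_int (h * m) \<and>
     real_of_int (cS h a b \<tau> m + m) / real_of_int (h * m) \<le> real_of_int a / real_of_int b"

text \<open>
  Under the standing assumptions \<open>\<lceil>(c - s)/m\<rceil> \<ge> \<lfloor>(h - i) a'/b'\<rfloor>\<close> holds for all
  \<open>s \<in> i\<Gamma>\<close>, \<open>0 \<le> i < h\<close> (lemma \<open>standing_depth_ge\<close> below). The element \<open>s\<close> is short
  when this lower bound is attained; requiring only \<open>\<ge>\<close> would be no condition.
\<close>

definition short_elem ::
    "int \<Rightarrow> int \<Rightarrow> int \<Rightarrow> int \<Rightarrow> int \<Rightarrow> nat \<Rightarrow> int \<Rightarrow> bool" where
  "short_elem h a' b' c m i s \<longleftrightarrow>
     \<lceil>real_of_int (c - s) / real_of_int m\<rceil>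
       \<le> \<lfloor>real_of_int ((h - int i) * a') / real_of_int b'\<rfloor>"

definition short_sg :: "int \<Rightarrow> int \<Rightarrow> int \<Rightarrow> int \<Rightarrow> int \<Rightarrow> nat set \<Rightarrow> int \<Rightarrow> int \<Rightarrow> bool" where
  "short_sg h a b a' b' \<Delta> \<tau> m \<longleftrightarrow>
     (\<forall>i. int i \<le> h - 1 \<longrightarrow>
        (\<forall>s\<in>iterated_sumset i (GammaS h a b \<Delta> \<tau> m).
           short_elem h a' b' (cS h a b \<tau> m) m i s))"

definition US :: "int \<Rightarrow> int \<Rightarrow> int \<Rightarrow> nat set \<Rightarrow> int \<Rightarrow> int \<Rightarrow> int \<Rightarrow> real set" where
  "US h a b \<Delta> \<tau> m i =
     (if i = 0 then {0}
      else {real_of_int (i * gamma1S h a b \<Delta> \<tau> m)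
              ..< real_of_int (i * (cS h a b \<tau> m + m)) / real_of_int h})"

definition split_sg :: "int \<Rightarrow> int \<Rightarrow> int \<Rightarrow> nat set \<Rightarrow> int \<Rightarrow> int \<Rightarrow> bool" where
  "split_sg h a b \<Delta> \<tau> m \<longleftrightarrow>
     disjoint_family_on (\<lambda>i. (\<lambda>x. x rmod real_of_int m) ` US h a b \<Delta> \<tau> m i) {0..h}"

definition tau_hat :: "int \<Rightarrow> int \<Rightarrow> nat set \<Rightarrow> int" where
  "tau_hat h b \<Delta> = \<lfloor>real_of_int ((h - b) * (h * int (Max \<Delta>) + 1)) / real_of_int b\<rfloor>"

definition m_hat :: "int \<Rightarrow> int \<Rightarrow> int \<Rightarrow> nat set \<Rightarrow> int" where
  "m_hat h b b' \<Delta> = ((b + b') * h - b * b') * int (Max \<Delta>) + b + b'"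

lemma sumset_le:
  assumes "\<And>g. g \<in> A \<Longrightarrow> real_of_int g \<le> B" and "s \<in> iterated_sumset i A"
  shows "real_of_int s \<le> real i * B"
proof -
  have "set xs \<subseteq> A \<Longrightarrow> real_of_int (sum_list xs) \<le> real (length xs) * B" for xs
    by (induction xs) (auto simp: algebra_simps intro: add_mono assms(1))
  then show ?thesis using assms(2) by (auto simp: iterated_sumset_def)
qed

lemma standing_depth_ge:
  assumes st: "standing h a b a' b' \<Delta> \<tau> m" and i: "int i \<le> h - 1"
    and l: "s \<in> iterated_sumset i (GammaS h a b \<Delta> \<tau> m)"
  shows "\<lfloor>real_of_int ((h - int i) * a') / real_of_int b'\<rfloor>
           \<le> \<lceil>real_of_int (cS h a b \<tau> m - s) / real_of_int m\<rceil>"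
proof -
  define C where "C = real_of_int (cS h a b \<tau> m)"
  define M where "M = real_of_int m"
  define H where "H = real_of_int h"
  define I where "I = real i"
  define R where "R = real_of_int a' / real_of_int b'"
  define Q where "Q = (C + M) / (H * M)"
  have M: "M > 0" and RQ: "R < Q"
    using st by (auto simp: standing_def M_def R_def Q_def C_def H_def)
  have HI: "H - I \<ge> 1" and H: "H > 0" using i by (auto simp: H_def I_def)
  have "real_of_int g \<le> (C + M) / H" if "g \<in> GammaS h a b \<Delta> \<tau> m" for g
  proof -
    let ?x = "real_of_int (cS h a b \<tau> m + m - 1) / real_of_int h"
    have "real_of_int g \<le> real_of_int \<lfloor>?x\<rfloor>"
      using that by (auto simp: GammaS_def)
    also have "\<dots> \<le> ?x" by (rule of_int_floor_le)
    also have "\<dots> \<le> (C + M) / H" using H by (auto simp: C_def M_def H_def divide_right_mono)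
    finally show ?thesis .
  qed
  from sumset_le[OF this l] have L: "real_of_int s \<le> I * ((C + M) / H)"
    by (simp add: I_def)
  have "(H - I) * R < (H - I) * Q" using RQ HI by simp
  also have "(H - I) * Q = (C - I * ((C + M) / H)) / M + 1"
    using M H by (simp add: Q_def field_simps)
  also have "\<dots> \<le> (C - real_of_int s) / M + 1"
    using L M by (simp add: divide_right_mono)
  finally have "(H - I) * R < (C - real_of_int s) / M + 1" .
  then have "real_of_int ((h - int i) * a') / real_of_int b'
      < real_of_int (cS h a b \<tau> m - s) / real_of_int m + 1"
    by (simp add: H_def I_def R_def C_def M_def)
  then show ?thesis by linarith
qed

end

theory Submission
  imports Defs
begin

text \<open>
  Everything is linear in integers once \<open>(m, \<gamma>\<^sub>1)\<close> is written in the lattice basis given by the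
  Farey neighbours: with \<open>X = a m - b \<gamma>\<^sub>1\<close> and \<open>Y = b' \<gamma>\<^sub>1 - a' m\<close> one has \<open>m = b' X + b Y\<close>,
  \<open>\<gamma>\<^sub>1 = a' X + a Y\<close> and \<open>b t = h X - b w\<close>. The conditions become
  (1) \<open>X \<ge> w\<close>, (2) \<open>X + \<lfloor>b/b'\<rfloor> Y \<ge> w\<close>, (3) \<open>h Y \<ge> (h - b') w\<close>, with an additional summand \<open>h\<close>
  on the right if \<open>b' = h\<close>.
  For \<open>1 \<le> d \<le> h\<close> and an integer \<open>k\<close>, put \<open>r = d a - k b\<close> and \<open>s = k b' - d a'\<close>; then
  \<open>d \<gamma>\<^sub>1 - k m = r Y - s X\<close> and \<open>d = r b' + s b\<close>. Because \<open>b + b' > h\<close>, the integers \<open>r\<close> and \<open>s\<close>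
  are not both positive, so that the extreme cases \<open>(r, s) = (0, 1)\<close>, \<open>(1, 0)\<close> and
  \<open>(-\<lfloor>b/b'\<rfloor>, 1)\<close> imply all others.
\<close>

section \<open>Lattice coordinates given by Farey neighbours\<close>

locale farey_neighbours =
  fixes h a b a' b' :: int
  assumes b: "1 \<le> b" "b \<le> h"
    and b': "1 \<le> b'" "b' \<le> h"
    and det: "a * b' - a' * b = 1"
    and h_less: "h < b + b'"
begin

text \<open>The matrix with rows \<open>(a, - b)\<close> and \<open>(- a', b')\<close> has
  determinant 1; this identity and the next one invert it.\<close>

lemma coord_first: "b' * (a * x - b * y) + b * (b' * y - a' * x) = x"
proof -
  have "b' * (a * x - b * y) + b * (b' * y - a' * x) = x * (a * b' - a' * b)"
    by (simp add: algebra_simps)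
  then show ?thesis by (simp add: det)
qed

lemma coord_second: "a' * (a * x - b * y) + a * (b' * y - a' * x) = y"
proof -
  have "a' * (a * x - b * y) + a * (b' * y - a' * x) = y * (a * b' - a' * b)"
    by (simp add: algebra_simps)
  then show ?thesis by (simp add: det)
qed

text \<open>
  Here \<open>(j - i) g - k m\<close> is the offset of \<open>U\<^sub>j\<close>, shifted by \<open>- k m\<close>, from \<open>U\<^sub>i\<close>; since the intervals
  have lengths \<open>i w / h\<close> and \<open>j w / h\<close>, the disjunction says that they are disjoint.
\<close>

lemma split_cond_iff:
  fixes X Y m g w :: int
  assumes m: "m = b' * X + b * Y" and g: "g = a' * X + a * Y" and w: "0 < w"
    and X: "b * w \<le> h * X" and Y: "- b' * w < h * Y"
  shows "(\<forall>i j k. 0 \<le> i \<and> i < j \<and> j \<le> h \<longrightarrow>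
           h * ((j - i) * g - k * m) + j * w \<le> 0 \<or>
           (if i = 0 then 0 < (j - i) * g - k * m else i * w \<le> h * ((j - i) * g - k * m)))
         \<longleftrightarrow> w \<le> X \<and> (h - b') * w + (if b' = h then h else 0) \<le> h * Y"
    (is "(\<forall>i j k. ?P i j k) \<longleftrightarrow> _")
proof (intro iffI conjI allI impI)
  assume P: "\<forall>i j k. ?P i j k"
  have h: "0 < h" using b by linarith
  have "0 < h * X" using X w b by (smt (verit) mult_pos_pos)
  then have X0: "0 < X" using h by (simp add: zero_less_mult_iff)
  have "b * g - a * m = - X * (a * b' - a' * b)" by (simp add: m g algebra_simps)
  then have eq1: "b * g - a * m = - X" by (simp add: det)
  have "b' * g - a' * m = Y * (a * b' - a' * b)" by (simp add: m g algebra_simps)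
  then have eq2: "b' * g - a' * m = Y" by (simp add: det)
  \<comment> \<open>The indices \<open>h - b\<close> and \<open>h\<close> with \<open>k = a\<close>
    are the case \<open>(r, s) = (0, 1)\<close>. The offset \<open>- X\<close> is negative, so only
    the first alternative can hold.\<close>
  have "h * (- X) + h * w \<le> 0 \<or>
      (if h - b = 0 then 0 < - X else (h - b) * w \<le> h * (- X))"
    using P[rule_format, of "h - b" h a] b by (simp add: eq1 split: if_splits)
  moreover have "\<not> (h - b) * w \<le> h * (- X)"
    using \<open>0 < h * X\<close> b w by (smt (verit) mult_minus_right mult_nonneg_nonneg)
  ultimately have "h * w \<le> h * X" using X0 by (auto split: if_splits)
  then show "w \<le> X" using h by simp
  \<comment> \<open>The case \<open>(r, s) = (1, 0)\<close> with offset \<open>Y\<close>; the lower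
    bound on \<open>Y\<close> rules out the first alternative. If \<open>b' = h\<close>, the lower
    index is 0, and the strict bound \<open>0 < Y\<close> between integers becomes the summand
    \<open>h\<close>.\<close>
  have "h * Y + h * w \<le> 0 \<or> (if h - b' = 0 then 0 < Y else (h - b') * w \<le> h * Y)"
    using P[rule_format, of "h - b'" h a'] b' by (simp add: eq2 split: if_splits)
  moreover have "b' * w \<le> h * w" using b' w by simp
  ultimately have *: "if h - b' = 0 then 0 < Y else (h - b') * w \<le> h * Y" using Y by simp
  show "(h - b') * w + (if b' = h then h else 0) \<le> h * Y"
    using * h by (auto split: if_splits)
next
  fix i j k
  assume XY: "w \<le> X \<and> (h - b') * w + (if b' = h then h else 0) \<le> h * Y"
    and ij: "0 \<le> i \<and> i < j \<and> j \<le> h"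
  define d where "d = j - i"
  define r where "r = d * a - k * b"
  define s where "s = k * b' - d * a'"
  have d: "1 \<le> d" "d \<le> h" "i \<le> h - d" using ij by (auto simp: d_def)
  have "r * b' + s * b = d * (a * b' - a' * b)" by (simp add: r_def s_def algebra_simps)
  then have rs: "d = r * b' + s * b" by (simp add: det)
  have n: "(j - i) * g - k * m = r * Y - s * X"
    by (simp add: d_def r_def s_def m g algebra_simps)
  have h: "0 < h" using b by linarith
  have Y0: "0 < Y"
  proof -
    have "0 < h * Y"
      using XY b' w h by (smt (verit) mult_pos_pos mult_eq_0_iff)
    then show ?thesis using h by (simp add: zero_less_mult_iff)
  qed
  show "h * ((j - i) * g - k * m) + j * w \<le> 0 \<or>
      (if i = 0 then 0 < (j - i) * g - k * m else i * w \<le> h * ((j - i) * g - k * m))"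
  proof (cases "r \<le> 0")
    case True
    \<comment> \<open>Here \<open>s \<ge> 1\<close>, so the offset is at most \<open>- w\<close>,
      and the shifted interval \<open>U\<^sub>j\<close>, of length at most \<open>w\<close>, ends no
      later than \<open>U\<^sub>i\<close> begins.\<close>
    have "r * b' \<le> 0" using True b' by (simp add: mult_le_0_iff)
    then have "0 < s * b" using rs d by linarith
    then have s: "1 \<le> s" using b by (simp add: zero_less_mult_iff)
    have "w \<le> s * X" using s XY w by (smt (verit) mult_le_cancel_right1)
    moreover have "r * Y \<le> 0" using True Y0 by (simp add: mult_le_0_iff)
    ultimately have "r * Y - s * X \<le> - w" by linarith
    then have "h * (r * Y - s * X) \<le> h * (- w)" using h by (simp del: mult_minus_right)
    moreover have "j * w \<le> h * w" using ij w by simp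
    ultimately show ?thesis unfolding n by simp
  next
    case False
    then have r: "1 \<le> r" by simp
    have s: "s \<le> 0"
    proof (rule ccontr)
      assume "\<not> s \<le> 0"
      then have "b \<le> s * b" "b' \<le> r * b'" using r b b' by simp_all
      then show False using rs d h_less by linarith
    qed
    have sX: "s * X \<le> s * w" using s XY by (simp add: mult_left_mono_neg)
    have "0 < r * Y" using r Y0 by simp
    moreover have "s * X \<le> 0" using sX s w by (smt (verit) mult_nonpos_nonneg)
    ultimately have pos: "0 < r * Y - s * X" by linarith
    \<comment> \<open>Combine \<open>r\<close> copies of the bound on \<open>Y\<close> with
      \<open>- s\<close> copies of \<open>h * w \<le> h * X\<close>. By
      \<open>d = r * b' + s * b\<close> the surplus over \<open>(h - d) * w\<close> is
      \<open>(r - 1) * h * w - s * (h - b) * w\<close>, which is nonnegative.\<close>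
    have "r * ((h - b') * w) \<le> r * (h * Y)"
      using XY r h by (intro mult_left_mono) (auto split: if_splits)
    moreover have "h * (s * X) \<le> h * (s * w)" using sX h by simp
    moreover have "0 \<le> (r - 1) * h * w" "s * (h - b) * w \<le> 0"
      using r s h b w by (intro mult_nonneg_nonneg mult_nonpos_nonneg; simp)+
    moreover have "r * ((h - b') * w) - h * (s * w) - (h - d) * w
        = (r - 1) * h * w - s * (h - b) * w"
      by (simp add: rs algebra_simps)
    moreover have "h * (r * Y - s * X) = r * (h * Y) - h * (s * X)"
      by (simp add: algebra_simps)
    moreover have "i * w \<le> (h - d) * w" using d w by simp
    ultimately have "i * w \<le> h * (r * Y - s * X)" by linarith
    then show ?thesis using pos unfolding n by simp
  qed
qed

text \<open>The index is \<open>j = h - i\<close>; only the smallest element \<open>i \<gamma>\<^sub>1\<close> of \<open>i\<Gamma>\<close> matters.\<close>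

lemma short_cond_iff:
  fixes X Y m g w :: int
  assumes m: "m = b' * X + b * Y" and g: "g = a' * X + a * Y" and w: "0 < w" "w \<le> m"
    and Y: "- b' * w < h * Y"
  shows "(\<forall>j. 1 \<le> j \<and> j \<le> h \<longrightarrow> j * g + w \<le> m * (j * a' div b' + 1))
         \<longleftrightarrow> w \<le> X \<and> w \<le> X + b div b' * Y"
    (is "(\<forall>j. ?P j) \<longleftrightarrow> _")
proof -
  have key: "j * g + w \<le> m * k \<longleftrightarrow> w \<le> (k * b' - j * a') * X - (j * a - k * b) * Y" for j k
    by (simp add: m g algebra_simps)
  have Y_lower: "- w < Y"
  proof -
    have "h * (- w) \<le> - b' * w" using b' w by simp
    then have "h * (- w) < h * Y" using Y by linarith
    then show ?thesis using b mult_less_cancel_left_pos[of h "- w" Y] by linarith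
  qed
  show ?thesis
  proof (intro iffI conjI allI impI)
    assume P: "\<forall>j. ?P j"
    \<comment> \<open>For \<open>j = b - q * b'\<close> the product \<open>j * a'\<close> is
      congruent to -1 modulo \<open>b'\<close>, so the division leaves the largest remainder. With
      \<open>k = a - q * a'\<close> the coefficients of \<open>X\<close> and \<open>Y\<close> in
      \<open>key\<close> are then 1 and \<open>q\<close>.\<close>
    have quot: "(b - q * b') * a' div b' + 1 = a - q * a'" for q
    proof -
      have "(b - q * b') * a' = (a - q * a' - 1) * b' + (b' - 1)"
        using det by (simp add: algebra_simps)
      then have "(b - q * b') * a' div b' = (b' - 1 + (a - q * a' - 1) * b') div b'"
        by (simp add: add.commute)
      also have "\<dots> = a - q * a' - 1"
        using b' by (subst div_mult_self1) (simp_all add: div_pos_pos_trivial)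
      finally show ?thesis by simp
    qed
    have bound: "w \<le> X + q * Y" if q: "1 \<le> b - q * b'" "0 \<le> q" for q
    proof -
      have "b - q * b' \<le> h" using q b b' by (smt (verit) mult_nonneg_nonneg)
      then have "(b - q * b') * g + w \<le> m * (a - q * a')"
        using P q(1) quot[of q] by metis
      moreover have "(a - q * a') * b' - (b - q * b') * a' = 1"
        using det by (simp add: algebra_simps)
      moreover have "(b - q * b') * a - (a - q * a') * b = - q * (a * b' - a' * b)"
        by (simp add: algebra_simps)
      ultimately show ?thesis unfolding key by (simp add: det)
    qed
    show "w \<le> X" using bound[of 0] b by simp
    show "w \<le> X + b div b' * Y"
      \<comment> \<open>If \<open>b'\<close> divides \<open>b\<close>, no \<open>j\<close> in range yields this bound; then \<open>b' = 1\<close> and it is \<open>w \<le> m\<close>.\<close>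
    proof (cases "b mod b' = 0")
      case True
      have "b' dvd 1"
        using True det by (metis dvd_diff dvd_mult dvd_triv_right mod_0_imp_dvd)
      then have "b' = 1" using b' by simp
      then show ?thesis using m w by simp
    next
      case False
      have "b - b div b' * b' = b mod b'" by (simp add: minus_div_mult_eq_mod)
      then have "1 \<le> b - b div b' * b'"
        using False b' by (smt (verit) pos_mod_sign)
      then show ?thesis using b b' by (intro bound) (simp_all add: pos_imp_zdiv_nonneg_iff)
    qed
  next
    fix j
    assume XY: "w \<le> X \<and> w \<le> X + b div b' * Y" and j: "1 \<le> j \<and> j \<le> h"
    define k where "k = j * a' div b' + 1"
    define r where "r = k * b - j * a"
    define s where "s = k * b' - j * a'"
    have "s = b' - j * a' mod b'"
      by (simp add: s_def k_def algebra_simps minus_div_mult_eq_mod [symmetric])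
    then have s: "1 \<le> s" using b' by (smt (verit) pos_mod_bound)
    have "s * b - r * b' = j * (a * b' - a' * b)" by (simp add: r_def s_def algebra_simps)
    then have rs: "j = s * b - r * b'" by (simp add: det)
    have r: "0 \<le> r"
    proof (rule ccontr)
      assume "\<not> 0 \<le> r"
      then have "b' \<le> (- r) * b'" using b' by (simp del: mult_minus_left)
      moreover have "b \<le> s * b" using s b by simp
      ultimately show False using rs j h_less by simp
    qed
    have "w \<le> s * X + r * Y"
    proof (cases "0 \<le> Y")
      case True
      have "w \<le> s * X" using s XY w by (smt (verit) mult_le_cancel_right1)
      moreover have "0 \<le> r * Y" using True r by simp
      ultimately show ?thesis by linarith
    next
      case False
      \<comment> \<open>From \<open>j > 0\<close> follows
        \<open>r * b' < s * b < s * (f + 1) * b'\<close>, so the worst value of \<open>r\<close> for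
        negative \<open>Y\<close> is \<open>s * f + (s - 1)\<close>. Then \<open>s\<close> copies of
        \<open>w \<le> X + f * Y\<close> yield \<open>s * w\<close>, and the remaining
        \<open>s - 1\<close> copies of \<open>Y\<close> lose at most \<open>w\<close> each.\<close>
      define f where "f = b div b'"
      have "b < (f + 1) * b'"
        using b' div_mult_mod_eq[of b b'] pos_mod_bound[of b' b]
        unfolding f_def distrib_right by linarith
      then have "s * b < s * ((f + 1) * b')" using s by simp
      then have "r * b' < s * (f + 1) * b'" using rs j by (simp add: algebra_simps)
      then have "r < s * (f + 1)" using b' by (simp add: mult_less_cancel_right)
      then have "r \<le> s * f + (s - 1)" by (simp add: algebra_simps)
      then have "(s * f + (s - 1)) * Y \<le> r * Y"
        using False by (intro mult_right_mono_neg) auto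
      moreover have "(s - 1) * (- w) \<le> (s - 1) * Y"
        using s Y_lower by (intro mult_left_mono) auto
      moreover have "s * w \<le> s * (X + f * Y)"
        using s XY by (intro mult_left_mono) (auto simp: f_def)
      ultimately show ?thesis by (simp add: algebra_simps)
    qed
    then show "j * g + w \<le> m * (j * a' div b' + 1)"
      unfolding k_def [symmetric] key by (simp add: r_def s_def algebra_simps)
  qed
qed

end

section \<open>The predecessor of a Farey fraction\<close>

text \<open>Solve \<open>a * q - p * b = 1\<close> with \<open>h - b < q \<le> h\<close>. Then
  \<open>p / q\<close> is a candidate for the predecessor, so \<open>s = a' * q - p * b'\<close> is
  nonnegative. If it were positive, \<open>b' = n * q + b * s\<close> would exceed \<open>h\<close>.
  Hence \<open>s = 0\<close>, so the determinant \<open>n\<close> divides both \<open>a'\<close> and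
  \<open>b'\<close> and is 1.\<close>

lemma farey_neighbours_pred:
  assumes ab: "farey_fraction h a b" and pred: "farey_pred h a b a' b'"
  shows "farey_neighbours h a b a' b'"
proof -
  have b: "1 \<le> b" "b \<le> h" "coprime a b" using ab by (auto simp: farey_fraction_def)
  have b': "1 \<le> b'" "b' \<le> h" "coprime a' b'" and lt: "a' * b < a * b'"
    using pred b
    by (auto simp: farey_pred_def farey_fraction_def divide_simps simp flip: of_int_mult)
  obtain u v where uv: "u * a + v * b = 1" using bezout_int[of a b] b(3) by auto
  \<comment> \<open>Shift the Bezout solution so that its denominator \<open>q\<close> lies in \<open>(h - b, h]\<close>.\<close>
  define l where "l = (h - u) div b"
  define q where "q = u + l * b"
  define p where "p = l * a - v"
  have det: "a * q - p * b = 1" using uv by (simp add: q_def p_def algebra_simps)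
  have "q = h - (h - u) mod b"
    by (simp add: q_def l_def minus_div_mult_eq_mod [symmetric])
  then have q: "h - b < q" "q \<le> h"
    using b pos_mod_bound[of b "h - u"] pos_mod_sign[of b "h - u"] by linarith+
  have "coprime p q"
    by (rule coprimeI) (metis det dvd_diff dvd_mult dvd_mult2)
  then have "farey_fraction h p q" using q b by (simp add: farey_fraction_def)
  moreover have "real_of_int p / real_of_int q < real_of_int a / real_of_int b"
  proof -
    have "p * b < a * q" using det by simp
    then show ?thesis using q b by (simp add: divide_simps flip: of_int_mult)
  qed
  ultimately have "real_of_int p / real_of_int q \<le> real_of_int a' / real_of_int b'"
    using pred by (auto simp: farey_pred_def)
  then have le: "p * b' \<le> a' * q"
    using q b b' by (simp add: divide_simps flip: of_int_mult)
  define n where "n = a * b' - a' * b"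
  define s where "s = a' * q - p * b'"
  have "n * q + b * s = b' * (a * q - p * b)" by (simp add: n_def s_def algebra_simps)
  then have bn: "b' = n * q + b * s" by (simp add: det)
  have n: "1 \<le> n" using lt by (simp add: n_def)
  have s0: "s = 0"
  proof (rule ccontr)
    assume "s \<noteq> 0"
    then have "1 \<le> s" using le by (simp add: s_def)
    then have "b \<le> b * s" "q \<le> n * q" using b q n by simp_all
    then show False using bn b' q by linarith
  qed
  have "a' = a' * (a * q - p * b)" by (simp add: det)
  also have "\<dots> = n * p + a * s" by (simp add: n_def s_def algebra_simps)
  finally have "n dvd a'" using s0 by simp
  moreover have "n dvd b'" using bn s0 by simp
  ultimately have "n dvd 1" using b'(3) by (metis coprime_def)
  then have n1: "n = 1" using n by simp
  then have "b' = q" using bn s0 by simp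
  then show ?thesis
    using b b' q n1 by unfold_locales (auto simp: n_def)
qed

section \<open>The smallest generator and the standing assumptions over the integers\<close>

lemma Min_diff_image:
  fixes k :: int and \<Delta> :: "nat set"
  assumes "finite \<Delta>" "\<Delta> \<noteq> {}"
  shows "Min ((\<lambda>\<delta>. k - int \<delta>) ` \<Delta>) = k - int (Max \<Delta>)"
  by (rule Min_eqI) (use assms in auto)

lemma gamma1S_eq:
  assumes "finite \<Delta>" "\<Delta> \<noteq> {}"
  shows "gamma1S h a b \<Delta> \<tau> m = (cS h a b \<tau> m + m - 1) div h - int (Max \<Delta>)"
  unfolding gamma1S_def GammaS_def floor_divide_of_int_eq by (rule Min_diff_image[OF assms])

lemma gamma1S_mem_le:
  assumes "finite \<Delta>" "\<Delta> \<noteq> {}"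
  shows "gamma1S h a b \<Delta> \<tau> m \<in> GammaS h a b \<Delta> \<tau> m"
    and "\<gamma> \<in> GammaS h a b \<Delta> \<tau> m \<Longrightarrow> gamma1S h a b \<Delta> \<tau> m \<le> \<gamma>"
  unfolding gamma1S_def using assms by (auto simp: GammaS_def)

text \<open>Up to the summand \<open>h * Max \<Delta>\<close>, \<open>w\<close> is the remainder of
  \<open>c + m - 1\<close> modulo \<open>h\<close> plus 1. The extremal semigroup attains this
  bound.\<close>

lemma wS_ge:
  assumes "finite \<Delta>" "\<Delta> \<noteq> {}" "0 < h"
  shows "h * int (Max \<Delta>) + 1 \<le> wS h a b \<Delta> \<tau> m"
proof -
  have "h * ((cS h a b \<tau> m + m - 1) div h) \<le> cS h a b \<tau> m + m - 1"
    using assms by (metis mult.commute div_mult_mod_eq pos_mod_sign le_add_same_cancel1)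
  then show ?thesis unfolding wS_def gamma1S_eq[OF assms(1,2)]
    by (simp add: algebra_simps)
qed

lemma wS_pos:
  assumes "finite \<Delta>" "\<Delta> \<noteq> {}" "0 < h"
  shows "0 < wS h a b \<Delta> \<tau> m"
  using wS_ge[OF assms, of a b \<tau> m] assms(3) by (smt (verit) mult_nonneg_nonneg of_nat_0_le_iff)

text \<open>The last two inequalities are the Farey bounds on \<open>(c + m) / (h * m)\<close>,
  cleared of denominators by \<open>c + m = h * g + w\<close>; in coordinates they are
  \<open>- b' * w < h * Y\<close> and \<open>b * w \<le> h * X\<close>.\<close>

lemma standing_iff:
  fixes h a b a' b' \<tau> m :: int and \<Delta> :: "nat set"
  assumes "0 < h" "0 < b" "0 < b'" "0 < m"
  defines "g \<equiv> gamma1S h a b \<Delta> \<tau> m" and "w \<equiv> wS h a b \<Delta> \<tau> m"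
  shows "standing h a b a' b' \<Delta> \<tau> m \<longleftrightarrow>
    m < cS h a b \<tau> m \<and> (\<forall>\<gamma>\<in>GammaS h a b \<Delta> \<tau> m. m < \<gamma>) \<and> w \<le> m \<and>
    - b' * w < h * (b' * g - a' * m) \<and> b * w \<le> h * (a * m - b * g)"
proof -
  have c: "cS h a b \<tau> m + m = h * g + w" by (simp add: w_def wS_def g_def)
  have "real_of_int a' / real_of_int b'
       < real_of_int (cS h a b \<tau> m + m) / real_of_int (h * m) \<longleftrightarrow> a' * (h * m) < (h * g + w) * b'"
    unfolding c using assms by (simp add: frac_less_eq divide_simps flip: of_int_mult of_int_add)
  also have "\<dots> \<longleftrightarrow> - b' * w < h * (b' * g - a' * m)" by (auto simp: algebra_simps)
  finally have 1: "real_of_int a' / real_of_int b'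
       < real_of_int (cS h a b \<tau> m + m) / real_of_int (h * m) \<longleftrightarrow> \<dots>" .
  have "real_of_int (cS h a b \<tau> m + m) / real_of_int (h * m) \<le> real_of_int a / real_of_int b
       \<longleftrightarrow> (h * g + w) * b \<le> a * (h * m)"
    unfolding c using assms by (simp add: divide_simps flip: of_int_mult of_int_add)
  also have "\<dots> \<longleftrightarrow> b * w \<le> h * (a * m - b * g)" by (auto simp: algebra_simps)
  finally have 2: "real_of_int (cS h a b \<tau> m + m) / real_of_int (h * m)
       \<le> real_of_int a / real_of_int b \<longleftrightarrow> \<dots>" .
  show ?thesis unfolding standing_def 1 2 using assms(4) by (simp add: w_def)
qed

section \<open>Shortness as a family of integer inequalities\<close>

lemma iterated_sumset_lower:
  assumes "\<And>x. x \<in> A \<Longrightarrow> g \<le> x" "s \<in> iterated_sumset i A"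
  shows "int i * g \<le> s"
proof -
  have "set xs \<subseteq> A \<Longrightarrow> int (length xs) * g \<le> sum_list xs" for xs
    by (induction xs) (auto simp: algebra_simps intro: add_mono assms(1))
  then show ?thesis using assms(2) by (auto simp: iterated_sumset_def)
qed

lemma iterated_sumset_mult:
  assumes "g \<in> A"
  shows "int i * g \<in> iterated_sumset i A"
  unfolding iterated_sumset_def using assms
  by (auto intro!: exI[of _ "replicate i g"] simp: sum_list_replicate)

lemma short_elem_iff:
  assumes "0 < m"
  shows "short_elem h a' b' c m i s \<longleftrightarrow> c \<le> s + m * ((h - int i) * a' div b')"
proof -
  have "short_elem h a' b' c m i s \<longleftrightarrow>
      real_of_int (c - s) / real_of_int m \<le> real_of_int ((h - int i) * a' div b')"
    unfolding short_elem_def floor_divide_of_int_eq ceiling_le_iff ..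
  also have "\<dots> \<longleftrightarrow> c - s \<le> (h - int i) * a' div b' * m"
    using assms by (simp add: pos_divide_le_eq flip: of_int_mult of_int_diff)
  also have "\<dots> \<longleftrightarrow> c \<le> s + m * ((h - int i) * a' div b')"
    by (auto simp: algebra_simps)
  finally show ?thesis .
qed

text \<open>Being short is easier for larger \<open>s\<close>, so for each \<open>i\<close> the
  minimum \<open>int i * g\<close> of the sumset decides. Then \<open>j = h - i\<close>, and the
  \<open>+ 1\<close> comes from \<open>c = h * g + w - m\<close>.\<close>

lemma short_sg_iff:
  fixes h a b a' b' \<tau> m :: int and \<Delta> :: "nat set"
  assumes "0 < m" and \<Delta>: "finite \<Delta>" "\<Delta> \<noteq> {}"
  defines "g \<equiv> gamma1S h a b \<Delta> \<tau> m" and "w \<equiv> wS h a b \<Delta> \<tau> m"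
  shows "short_sg h a b a' b' \<Delta> \<tau> m \<longleftrightarrow>
    (\<forall>j. 1 \<le> j \<and> j \<le> h \<longrightarrow> j * g + w \<le> m * (j * a' div b' + 1))"
proof -
  have c: "cS h a b \<tau> m = h * g + w - m" by (simp add: w_def wS_def g_def)
  have eq: "(\<forall>s\<in>iterated_sumset i (GammaS h a b \<Delta> \<tau> m).
         short_elem h a' b' (cS h a b \<tau> m) m i s) \<longleftrightarrow>
      (h - int i) * g + w \<le> m * ((h - int i) * a' div b' + 1)" (is "?L i \<longleftrightarrow> ?R i") for i
  proof -
    have "?L i \<longleftrightarrow> cS h a b \<tau> m \<le> int i * g + m * ((h - int i) * a' div b')"
    proof
      assume "?L i"
      moreover have "int i * g \<in> iterated_sumset i (GammaS h a b \<Delta> \<tau> m)"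
        unfolding g_def by (rule iterated_sumset_mult[OF gamma1S_mem_le(1)[OF \<Delta>]])
      ultimately show "cS h a b \<tau> m \<le> int i * g + m * ((h - int i) * a' div b')"
        unfolding short_elem_iff[OF assms(1)] by blast
    next
      assume le: "cS h a b \<tau> m \<le> int i * g + m * ((h - int i) * a' div b')"
      have "int i * g \<le> s" if "s \<in> iterated_sumset i (GammaS h a b \<Delta> \<tau> m)" for s
        unfolding g_def by (rule iterated_sumset_lower[OF gamma1S_mem_le(2)[OF \<Delta>] that])
      then show "?L i"
        unfolding short_elem_iff[OF assms(1)] using le by (meson add_right_mono order_trans)
    qed
    also have "\<dots> \<longleftrightarrow> ?R i" unfolding c by (auto simp: algebra_simps)
    finally show ?thesis .
  qed
  show ?thesis unfolding short_sg_def eq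
  proof (intro iffI allI impI)
    fix j assume "\<forall>i. int i \<le> h - 1 \<longrightarrow> ?R i" and "1 \<le> j \<and> j \<le> h"
    then show "j * g + w \<le> m * (j * a' div b' + 1)" by (auto dest: spec[of _ "nat (h - j)"])
  qed auto
qed

section \<open>Disjointness modulo \<open>m\<close>\<close>

lemma rmod_images_meet_iff:
  assumes "m \<noteq> 0"
  shows "(\<lambda>x. x rmod m) ` A \<inter> (\<lambda>x. x rmod m) ` B \<noteq> {} \<longleftrightarrow>
    (\<exists>k. \<exists>x\<in>A. x + of_int k * m \<in> B)"
proof
  assume "(\<lambda>x. x rmod m) ` A \<inter> (\<lambda>x. x rmod m) ` B \<noteq> {}"
  then obtain x y where xy: "x \<in> A" "y \<in> B" "x rmod m = y rmod m" by auto
  then have "[x = y] (rmod m)" by (simp add: rcong_def)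
  then obtain k where "y = x + of_int k * m" unfolding rcong_altdef by auto
  then show "\<exists>k. \<exists>x\<in>A. x + of_int k * m \<in> B" using xy by auto
next
  assume "\<exists>k. \<exists>x\<in>A. x + of_int k * m \<in> B"
  then obtain k x where x: "x \<in> A" "x + of_int k * m \<in> B" by auto
  have "[x = x + of_int k * m] (rmod m)" unfolding rcong_altdef by auto
  then show "(\<lambda>x. x rmod m) ` A \<inter> (\<lambda>x. x rmod m) ` B \<noteq> {}"
    using x unfolding rcong_def by auto
qed

lemma Ico_meets_shift_iff:
  fixes p q u v z :: real
  assumes "p < q" "u < v"
  shows "(\<exists>x\<in>{p..<q}. x + z \<in> {u..<v}) \<longleftrightarrow> u < q + z \<and> p + z < v"
proof
  assume "u < q + z \<and> p + z < v"
  \<comment> \<open>The witness is the left end of the intersection, which both half-open intervals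
    contain.\<close>
  then show "\<exists>x\<in>{p..<q}. x + z \<in> {u..<v}"
    using assms by (intro bexI[of _ "max p (u - z)"]) auto
qed auto

text \<open>By \<open>c + m = h * g + w\<close>, the set \<open>U\<^sub>i\<close> with
  \<open>i > 0\<close> starts at \<open>i * g\<close> and has length \<open>i * w / h\<close>, so
  multiplication by \<open>h\<close> makes all ends integers. The case \<open>i = 0\<close> is
  strict because \<open>U\<^sub>0\<close> is a point, which must also avoid the closed left end of
  \<open>U\<^sub>j\<close>.\<close>

lemma split_sg_iff:
  fixes h a b \<tau> m :: int and \<Delta> :: "nat set"
  assumes "0 < m" "0 < h"
  defines "g \<equiv> gamma1S h a b \<Delta> \<tau> m" and "w \<equiv> wS h a b \<Delta> \<tau> m"
  assumes w: "0 < w"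
  shows "split_sg h a b \<Delta> \<tau> m \<longleftrightarrow>
    (\<forall>i j k. 0 \<le> i \<and> i < j \<and> j \<le> h \<longrightarrow>
      h * ((j - i) * g - k * m) + j * w \<le> 0 \<or>
      (if i = 0 then 0 < (j - i) * g - k * m else i * w \<le> h * ((j - i) * g - k * m)))"
    (is "_ \<longleftrightarrow> (\<forall>i j k. _ \<longrightarrow> ?P i j k)")
proof -
  let ?U = "US h a b \<Delta> \<tau> m"
  let ?F = "\<lambda>i. (\<lambda>x. x rmod real_of_int m) ` ?U i"
  have c: "cS h a b \<tau> m + m = h * g + w" by (simp add: w_def wS_def g_def)
  have U: "?U i = {real_of_int (i * g) ..< real_of_int (i * g) + real_of_int (i * w) / real_of_int h}"
    if "i \<noteq> 0" for i
    using that assms(2) unfolding US_def c by (simp add: g_def field_simps)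
  have U0: "?U 0 = {0}" by (simp add: US_def)
  have P: "(\<exists>x\<in>?U i. x + real_of_int k * real_of_int m \<in> ?U j) \<longleftrightarrow> \<not> ?P i j k"
    if ij: "0 \<le> i" "i < j" for i j k
  proof (cases "i = 0")
    case True
    have "(\<exists>x\<in>?U i. x + real_of_int k * real_of_int m \<in> ?U j) \<longleftrightarrow>
        real_of_int (j * g) \<le> real_of_int (k * m) \<and>
        real_of_int (k * m) < real_of_int (j * g) + real_of_int (j * w) / real_of_int h"
      using ij True by (simp add: U0 U)
    also have "\<dots> \<longleftrightarrow> j * g \<le> k * m \<and>
        real_of_int (h * (k * m)) < real_of_int (h * (j * g) + j * w)"
      using assms(2) by (simp add: field_simps flip: of_int_mult)
    also have "\<dots> \<longleftrightarrow> \<not> ?P i j k"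
      unfolding of_int_less_iff using True by (auto simp: algebra_simps)
    finally show ?thesis .
  next
    case False
    have pos: "0 < real_of_int (l * w) / real_of_int h" if "0 < l" for l
      using that assms(2) w by simp
    have "(\<exists>x\<in>?U i. x + real_of_int k * real_of_int m \<in> ?U j) \<longleftrightarrow>
        real_of_int (j * g) < real_of_int (i * g) + real_of_int (i * w) / real_of_int h
           + real_of_int k * real_of_int m \<and>
        real_of_int (i * g) + real_of_int k * real_of_int m
           < real_of_int (j * g) + real_of_int (j * w) / real_of_int h"
      using ij False pos[of i] pos[of j] by (simp add: U Ico_meets_shift_iff del: atLeastLessThan_iff)
    also have "\<dots> \<longleftrightarrow>
        real_of_int (h * (j * g)) < real_of_int (h * (i * g) + i * w + h * (k * m)) \<and>
        real_of_int (h * (i * g) + h * (k * m)) < real_of_int (h * (j * g) + j * w)"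
      using assms(2) by (simp add: field_simps)
    also have "\<dots> \<longleftrightarrow> \<not> ?P i j k"
      unfolding of_int_less_iff using False by (auto simp: algebra_simps)
    finally show ?thesis .
  qed
  have meet: "?F i \<inter> ?F j = {} \<longleftrightarrow> (\<forall>k. ?P i j k)" if "0 \<le> i" "i < j" for i j
  proof -
    have "?F i \<inter> ?F j \<noteq> {} \<longleftrightarrow> (\<exists>k. \<not> ?P i j k)"
      unfolding P[OF that, symmetric] using assms(1) by (intro rmod_images_meet_iff) simp
    then show ?thesis unfolding not_all[symmetric] by argo
  qed
  have "split_sg h a b \<Delta> \<tau> m \<longleftrightarrow> (\<forall>i j. 0 \<le> i \<and> i < j \<and> j \<le> h \<longrightarrow> ?F i \<inter> ?F j = {})"
    unfolding split_sg_def disjoint_family_on_def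
  proof (intro iffI allI impI ballI)
    fix i j
    assume F: "\<forall>i j. 0 \<le> i \<and> i < j \<and> j \<le> h \<longrightarrow> ?F i \<inter> ?F j = {}"
      and ij: "i \<in> {0..h}" "j \<in> {0..h}" "i \<noteq> j"
    show "?F i \<inter> ?F j = {}"
    proof (cases "i < j")
      case False
      then have "?F j \<inter> ?F i = {}" using F ij by simp
      then show ?thesis by blast
    qed (use F ij in simp)
  qed simp
  also have "\<dots> \<longleftrightarrow> (\<forall>i j k. 0 \<le> i \<and> i < j \<and> j \<le> h \<longrightarrow> ?P i j k)"
    by (simp only: all_simps) (intro all_cong1 imp_cong refl meet; simp)
  finally show ?thesis .
qed

section \<open>Split semigroups and the extremal one\<close>

context farey_neighbours
begin

lemma split_sg_iff_coords:
  fixes \<tau> m :: int and \<Delta> :: "nat set"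
  assumes h: "2 \<le> h" and \<Delta>: "finite \<Delta>" "\<Delta> \<noteq> {}" and st: "standing h a b a' b' \<Delta> \<tau> m"
  defines "g \<equiv> gamma1S h a b \<Delta> \<tau> m" and "w \<equiv> wS h a b \<Delta> \<tau> m"
  shows "split_sg h a b \<Delta> \<tau> m \<longleftrightarrow> w \<le> a * m - b * g \<and>
    (h - b') * w + (if b' = h then h else 0) \<le> h * (b' * g - a' * m)"
proof -
  have m: "0 < m" using st by (simp add: standing_def)
  have pos: "0 < h" "0 < b" "0 < b'" using h b b' by auto
  have w: "0 < w"
    unfolding w_def using wS_pos[OF \<Delta> pos(1)] .
  have "- b' * w < h * (b' * g - a' * m)" "b * w \<le> h * (a * m - b * g)"
    using st m pos by (simp_all add: standing_iff g_def w_def)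
  from split_cond_iff[OF coord_first[symmetric] coord_second[symmetric] w this(2,1)]
  show ?thesis
    using split_sg_iff[OF m pos(1) w[unfolded w_def]] by (simp only: g_def w_def)
qed

text \<open>The extremal semigroup has the least possible \<open>w\<close>, the coordinate
  \<open>X = w\<close>, and the least integer \<open>Y\<close> that (3) admits for this
  \<open>w\<close>. These choices explain the formulas for \<open>m_hat\<close> and
  \<open>tau_hat\<close>.\<close>

lemma hat_eqs:
  fixes \<Delta> :: "nat set"
  assumes \<Delta>: "finite \<Delta>" "\<Delta> \<noteq> {}"
  defines "\<tau> \<equiv> tau_hat h b \<Delta>" and "m \<equiv> m_hat h b b' \<Delta>"
    and "X \<equiv> h * int (Max \<Delta>) + 1" and "Y \<equiv> (h - b') * int (Max \<Delta>) + 1"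
  defines "g \<equiv> a' * X + a * Y"
  shows "m = b' * X + b * Y" "cS h a b \<tau> m + m = h * g + X"
    "gamma1S h a b \<Delta> \<tau> m = g" "wS h a b \<Delta> \<tau> m = X" "a * m - b * g = X" "b' * g - a' * m = Y"
proof -
  show m: "m = b' * X + b * Y" by (simp add: m_def m_hat_def X_def Y_def algebra_simps)
  have "a * m - b * g = (a * b' - a' * b) * X" by (simp add: m g_def algebra_simps)
  then show X: "a * m - b * g = X" by (simp add: det)
  have "b' * g - a' * m = (a * b' - a' * b) * Y" by (simp add: m g_def algebra_simps)
  then show "b' * g - a' * m = Y" by (simp add: det)
  have b0: "b \<noteq> 0" using b by simp
  have "a * h * m = h * (a * m - b * g) + h * g * b" by (simp add: algebra_simps)
  then have "(a * h * m) div b = (h * X) div b + h * g"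
    using b0 by (simp add: X)
  moreover have "\<tau> = (h * X) div b - X"
  proof -
    have "\<tau> = ((h - b) * X) div b" unfolding \<tau>_def tau_hat_def X_def floor_divide_of_int_eq ..
    also have "(h - b) * X = h * X + (- X) * b" by (simp add: algebra_simps)
    finally show ?thesis using div_mult_self1[OF b0, of "h * X" "- X"] by simp
  qed
  ultimately show c: "cS h a b \<tau> m + m = h * g + X"
    unfolding cS_def floor_divide_of_int_eq by simp
  \<comment> \<open>The division is exact since \<open>X - 1 = h * Max \<Delta>\<close>.\<close>
  have "(h * g + X - 1) div h = g + int (Max \<Delta>)"
  proof -
    have "h * g + X - 1 = h * (g + int (Max \<Delta>))" by (simp add: X_def algebra_simps)
    then show ?thesis using b by simp
  qed
  then show g: "gamma1S h a b \<Delta> \<tau> m = g" by (simp add: gamma1S_eq[OF \<Delta>] c)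
  show "wS h a b \<Delta> \<tau> m = X" by (simp add: wS_def g c)
qed

text \<open>The hypothesis \<open>b < a\<close> gives \<open>m < g\<close>: the determinant relation
  turns it into \<open>b' \<le> a'\<close>, and
  \<open>g - m = (a' - b') * X + (a - b) * Y\<close>.\<close>

lemma standing_hat:
  fixes \<Delta> :: "nat set"
  assumes h: "2 \<le> h" and \<Delta>: "finite \<Delta>" "\<Delta> \<noteq> {}" and "b < a"
  shows "standing h a b a' b' \<Delta> (tau_hat h b \<Delta>) (m_hat h b b' \<Delta>)"
proof -
  define \<tau> where "\<tau> = tau_hat h b \<Delta>"
  define m where "m = m_hat h b b' \<Delta>"
  define X where "X = h * int (Max \<Delta>) + 1"
  define Y where "Y = (h - b') * int (Max \<Delta>) + 1"
  define g where "g = a' * X + a * Y"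
  note eqs = hat_eqs[OF \<Delta>, folded \<tau>_def m_def X_def Y_def, folded g_def]
  have X: "1 \<le> X" and Y: "1 \<le> Y" using h b' by (simp_all add: X_def Y_def)
  have m_ge: "X + 1 \<le> m"
  proof -
    have "X \<le> b' * X" "Y \<le> b * Y" using X Y b b' by simp_all
    then show ?thesis using Y eqs(1) by linarith
  qed
  have "m < g"
  proof -
    have "b' \<le> (a - b) * b'" using b' \<open>b < a\<close> by simp
    moreover have "(a' - b') * b = (a - b) * b' - 1" using det by (simp add: algebra_simps)
    ultimately have "0 \<le> (a' - b') * b" using b' by linarith
    then have "0 \<le> a' - b'" using b by (simp add: zero_le_mult_iff)
    then have "0 \<le> (a' - b') * X" using X by simp
    moreover have "Y \<le> (a - b) * Y" using \<open>b < a\<close> Y by simp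
    moreover have "g - m = (a' - b') * X + (a - b) * Y"
      by (simp add: eqs(1) g_def algebra_simps)
    ultimately show ?thesis using Y by linarith
  qed
  have "2 * g \<le> h * g" using h \<open>m < g\<close> m_ge X by simp
  then have "m < cS h a b \<tau> m" using eqs(2) \<open>m < g\<close> X by linarith
  moreover have "\<forall>\<gamma>\<in>GammaS h a b \<Delta> \<tau> m. m < \<gamma>"
    using gamma1S_mem_le(2)[OF \<Delta>, of _ h a b \<tau> m] \<open>m < g\<close> eqs(3) by fastforce
  moreover have "- b' * X < h * Y"
  proof -
    have "0 < b' * X" "0 < h * Y" using X Y b' h by simp_all
    then show ?thesis by simp
  qed
  moreover have "b * X \<le> h * X" using b X by simp
  ultimately have "standing h a b a' b' \<Delta> \<tau> m"
    using m_ge h b b' X by (subst standing_iff) (simp_all add: eqs(3-6))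
  then show ?thesis by (simp add: \<tau>_def m_def)
qed

text \<open>The first condition is the equality \<open>X = w\<close>; in the second,
  \<open>h * Y - (h - b') * w\<close> is exactly \<open>b'\<close>, which covers the summand
  \<open>h\<close> when \<open>b' = h\<close>.\<close>

lemma split_sg_hat:
  fixes \<Delta> :: "nat set"
  assumes "2 \<le> h" "finite \<Delta>" "\<Delta> \<noteq> {}" "b < a"
  shows "split_sg h a b \<Delta> (tau_hat h b \<Delta>) (m_hat h b b' \<Delta>)"
  using b' unfolding split_sg_iff_coords[OF assms(1-3) standing_hat[OF assms]]
    hat_eqs(3-6)[OF assms(2,3)] by (simp add: algebra_simps)

text \<open>Both coordinates are at least their extremal values, and
  \<open>m = b' * X + b * Y\<close> increases with them. Moreover
  \<open>\<tau> = (h * X) div b - w\<close>, which by \<open>w \<le> X\<close> is at least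
  \<open>((h - b) * w) div b\<close>, a monotone function of \<open>w\<close>.\<close>

lemma hat_minimal:
  fixes \<tau> m :: int and \<Delta> :: "nat set"
  assumes h: "2 \<le> h" and \<Delta>: "finite \<Delta>" "\<Delta> \<noteq> {}" and st: "standing h a b a' b' \<Delta> \<tau> m"
    and split: "split_sg h a b \<Delta> \<tau> m"
  shows "tau_hat h b \<Delta> \<le> \<tau>" "m_hat h b b' \<Delta> \<le> m"
proof -
  define g where "g = gamma1S h a b \<Delta> \<tau> m"
  define w where "w = wS h a b \<Delta> \<tau> m"
  define \<delta> where "\<delta> = int (Max \<Delta>)"
  define X where "X = a * m - b * g"
  define Y where "Y = b' * g - a' * m"
  have X: "w \<le> X" and Y: "(h - b') * w + (if b' = h then h else 0) \<le> h * Y"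
    using split unfolding split_sg_iff_coords[OF h \<Delta> st]
    by (simp_all add: g_def w_def X_def Y_def)
  have w: "h * \<delta> + 1 \<le> w"
    using wS_ge[OF \<Delta>, of h a b \<tau> m] h by (simp add: w_def \<delta>_def)
  have "(h - b') * (h * \<delta> + 1) \<le> (h - b') * w" using w b' by (intro mult_left_mono) auto
  moreover have "(h - b') * (h * \<delta> + 1) = h * ((h - b') * \<delta>) + (h - b')"
    by (simp add: algebra_simps)
  \<comment> \<open>Strictness comes from the extra summand \<open>h\<close> if
    \<open>b' = h\<close>, and from the term \<open>h - b' > 0\<close> otherwise; it rounds
    \<open>Y\<close> up to \<open>(h - b') * \<delta> + 1\<close>.\<close>
  moreover have "(h - b') * w < h * Y \<or> (h - b') * w \<le> h * Y \<and> b' < h"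
    using Y b' h by (auto split: if_splits)
  ultimately have "h * ((h - b') * \<delta>) < h * Y" using b' by linarith
  then have "(h - b') * \<delta> + 1 \<le> Y" using h by simp
  then have "b * ((h - b') * \<delta> + 1) \<le> b * Y" using b by simp
  moreover have "b' * (h * \<delta> + 1) \<le> b' * X" using w X b' by simp
  moreover have "m = b' * X + b * Y" by (simp add: X_def Y_def coord_first)
  moreover have "m_hat h b b' \<Delta> = b' * (h * \<delta> + 1) + b * ((h - b') * \<delta> + 1)"
    by (simp add: m_hat_def \<delta>_def algebra_simps)
  ultimately show "m_hat h b b' \<Delta> \<le> m" by linarith
  have "h * g + w = (a * h * m) div b - \<tau>"
    unfolding g_def w_def wS_def cS_def floor_divide_of_int_eq by simp
  moreover have "a * h * m = (h * X) + (h * g) * b" by (simp add: X_def algebra_simps)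
  then have "(a * h * m) div b = (h * X) div b + h * g" using b by simp
  ultimately have "\<tau> = (h * X) div b - w" by simp
  moreover have "(h * w) div b \<le> (h * X) div b"
    using X b h by (intro zdiv_mono1) auto
  moreover have "(h * w) div b - w = ((h - b) * w) div b"
  proof -
    have "(h - b) * w = h * w + (- w) * b" by (simp add: algebra_simps)
    then show ?thesis using b div_mult_self1[of b "h * w" "- w"] by simp
  qed
  moreover have "tau_hat h b \<Delta> \<le> ((h - b) * w) div b"
    unfolding tau_hat_def floor_divide_of_int_eq
    using w b by (intro zdiv_mono1 mult_left_mono) (auto simp: \<delta>_def)
  ultimately show "tau_hat h b \<Delta> \<le> \<tau>" by linarith
qed

end

section \<open>Conditions (1) to (3) in coordinates\<close>

theorem theorem2p8:
  fixes h a b a' b' \<tau> m bbar :: int and \<Delta> :: "nat set" and t w :: real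
    and cond1 cond2 cond3 :: bool
  assumes h: "h \<ge> 2"
    and farey: "farey_fraction h a b"
    and pred: "farey_pred h a b a' b'"
    and Delta: "finite \<Delta>" "\<Delta> \<noteq> {}"
    and st: "standing h a b a' b' \<Delta> \<tau> m"
    and t: "t = tS h a b \<tau> m"
    and w: "w = real_of_int (wS h a b \<Delta> \<tau> m)"
    and bbar: "bbar = b mod b'"
    and cond1: "cond1 \<longleftrightarrow> t \<ge> real_of_int (h - b) * w / real_of_int b"
    and cond2: "cond2 \<longleftrightarrow> real_of_int ((b - bbar) * m)
        \<ge> real_of_int (b * b') * (real_of_int (h - bbar) * w - real_of_int bbar * t) / real_of_int h"
    and cond3: "cond3 \<longleftrightarrow> real_of_int m
        \<ge> real_of_int (b * b') * t / real_of_int h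
            + real_of_int b * (w + (if b' = h then 1 else 0))"
  shows
    "(canonically_defined m (GammaS h a b \<Delta> \<tau> m) (cS h a b \<tau> m) \<longrightarrow>
        (short_sg h a b a' b' \<Delta> \<tau> m \<longleftrightarrow> cond1 \<and> cond2)) \<and>
     (split_sg h a b \<Delta> \<tau> m \<longleftrightarrow> cond1 \<and> cond3) \<and>
     (standing h a b a' b' \<Delta> (tau_hat h b \<Delta>) (m_hat h b b' \<Delta>) \<and>
      split_sg h a b \<Delta> (tau_hat h b \<Delta>) (m_hat h b b' \<Delta>) \<and>
      (split_sg h a b \<Delta> \<tau> m \<longrightarrow> \<tau> \<ge> tau_hat h b \<Delta> \<and> m \<ge> m_hat h b b' \<Delta>))"
proof -
  interpret farey_neighbours h a b a' b'
    by (rule farey_neighbours_pred[OF farey pred])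
  define g where "g = gamma1S h a b \<Delta> \<tau> m"
  define W where "W = wS h a b \<Delta> \<tau> m"
  define X where "X = a * m - b * g"
  define Y where "Y = b' * g - a' * m"
  define e :: int where "e = (if b' = h then 1 else 0)"
  have m: "0 < m" using st by (simp add: standing_def)
  have m_eq: "m = b' * X + b * Y" and g_eq: "g = a' * X + a * Y"
    by (simp_all add: X_def Y_def coord_first coord_second)
  have W: "0 < W"
    using wS_pos[OF Delta, of h a b \<tau> m] h by (simp add: W_def)
  have pos: "0 < h" "0 < b" "0 < b'" using h b b' by auto
  have bounds: "W \<le> m" "- b' * W < h * Y" "b * W \<le> h * X" "m < g"
    using st m pos gamma1S_mem_le(1)[OF Delta, of h a b \<tau> m]
    by (auto simp: standing_iff g_def W_def X_def Y_def)
  have bt: "real_of_int b * t = real_of_int (h * X - b * W)"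
    using pos unfolding t tS_def X_def W_def wS_def g_def by (simp add: field_simps)
  have c1: "cond1 \<longleftrightarrow> W \<le> X"
  proof -
    have "cond1 \<longleftrightarrow> real_of_int ((h - b) * W) \<le> real_of_int b * t"
      using pos by (simp add: cond1 w W_def divide_le_eq mult.commute)
    also have "\<dots> \<longleftrightarrow> h * W \<le> h * X"
      unfolding bt of_int_le_iff by (auto simp: algebra_simps)
    also have "\<dots> \<longleftrightarrow> W \<le> X" using pos by simp
    finally show ?thesis .
  qed
  have c2: "cond2 \<longleftrightarrow> W \<le> X + b div b' * Y"
  proof -
    define f where "f = b div b'"
    have f: "bbar = b - f * b'" by (simp add: bbar f_def minus_div_mult_eq_mod)
    \<comment> \<open>The right side of (2) is \<open>N / h\<close>; the difference of the two
      sides, times \<open>h\<close>, turns out to be \<open>h * b * b'\<close> times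
      \<open>X + f * Y - W\<close>.\<close>
    define N where "N = b * b' * (h - bbar) * W - b' * bbar * (h * X - b * W)"
    have "real_of_int (b * b') * (real_of_int (h - bbar) * w - real_of_int bbar * t)
        = real_of_int (b * b' * (h - bbar) * W) - real_of_int (b' * bbar) * (real_of_int b * t)"
      by (simp add: w W_def algebra_simps)
    also have "\<dots> = real_of_int N" unfolding bt N_def by simp
    finally have "cond2 \<longleftrightarrow> real_of_int N / real_of_int h \<le> real_of_int ((b - bbar) * m)"
      unfolding cond2 by simp
    also have "\<dots> \<longleftrightarrow> N \<le> (b - bbar) * m * h"
      using pos by (simp add: pos_divide_le_eq flip: of_int_mult)
    also have "\<dots> \<longleftrightarrow> 0 \<le> (b - bbar) * m * h - N" by simp
    also have "(b - bbar) * m * h - N = (h * b * b') * (X + f * Y - W)"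
      unfolding N_def m_eq f by (simp add: algebra_simps)
    also have "0 \<le> \<dots> \<longleftrightarrow> 0 \<le> X + f * Y - W"
      using pos mult_le_cancel_left_pos[of "h * b * b'" 0 "X + f * Y - W"] by simp
    finally show ?thesis by (simp add: f_def)
  qed
  have c3: "cond3 \<longleftrightarrow> (h - b') * W + (if b' = h then h else 0) \<le> h * Y"
  proof -
    define N where "N = b' * (h * X - b * W) + b * (W + e) * h"
    have "real_of_int (b * b') * t / real_of_int h + real_of_int b * (w + (if b' = h then 1 else 0))
        = (real_of_int b' * (real_of_int b * t) + real_of_int (b * (W + e) * h)) / real_of_int h"
      using pos by (simp add: w W_def e_def field_simps)
    also have "\<dots> = real_of_int N / real_of_int h" unfolding bt N_def by simp
    finally have "cond3 \<longleftrightarrow> real_of_int N / real_of_int h \<le> real_of_int m"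
      unfolding cond3 by simp
    also have "\<dots> \<longleftrightarrow> N \<le> m * h"
      using pos by (simp add: pos_divide_le_eq flip: of_int_mult)
    also have "\<dots> \<longleftrightarrow> 0 \<le> m * h - N" by simp
    also have "m * h - N = b * (h * Y - ((h - b') * W + h * e))"
      unfolding N_def m_eq by (simp add: algebra_simps)
    also have "0 \<le> \<dots> \<longleftrightarrow> 0 \<le> h * Y - ((h - b') * W + h * e)"
      using pos by (simp add: zero_le_mult_iff del: diff_ge_0_iff_ge)
    finally show ?thesis by (simp add: e_def)
  qed
  have short: "short_sg h a b a' b' \<Delta> \<tau> m \<longleftrightarrow> cond1 \<and> cond2"
    unfolding short_sg_iff[OF m Delta] c1 c2 g_def[symmetric] W_def[symmetric]
    by (rule short_cond_iff[OF m_eq g_eq W bounds(1,2)])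
  have split: "split_sg h a b \<Delta> \<tau> m \<longleftrightarrow> cond1 \<and> cond3"
    unfolding split_sg_iff_coords[OF h Delta st] c1 c3
    by (simp add: g_def W_def X_def Y_def)
  \<comment> \<open>The given semigroup has \<open>X > 0\<close> and \<open>g > m\<close>, so
    \<open>a * m > b * g > b * m\<close>.\<close>
  have "b < a"
  proof -
    have "0 < b * W" using pos W by simp
    then have "0 < h * X" using bounds by linarith
    then have "b * g < a * m" using pos by (simp add: zero_less_mult_iff X_def)
    moreover have "b * m < b * g" using bounds pos by simp
    ultimately have "b * m < a * m" by linarith
    then show ?thesis using m by simp
  qed
  then show ?thesis
    using short split standing_hat[OF h Delta] split_sg_hat[OF h Delta]
      hat_minimal[OF h Delta st] by blast
qed

end
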